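(* Let $S$ be a finite set of schemas, $n=|S|$, $h=\max_{\sigma\in S}|\exists(\wp(\sigma))|$, $k=\max_{\sigma\in S}|\mathrm{args}(\sigma)|$. There exists a coupling map $c^\star$ for $S$ over a finite set $D^\star$ with $|D^\star|\le n\cdot h\cdot 2^{(n\cdot k)!}$ such that, for all $A'\subseteq A\subseteq\mathrm{Args}$ and all $S'\subseteq S\cap\mathrm{Sch}(A)$, if $S'$ is not overlapping over $A'$ then $c^\star$ is untangled with respect to $S'$ over $A'$.
   Context: $\mathrm{Args}$ is a finite non-empty set of arguments, $\mathrm{Var}$ a set of variables. A quantification prefix $\wp$ is a finite word over $\{\exists x,\forall x:x\in\mathrm{Var}\}$ with each variable at most once; $\mathrm{vars}(\wp)$, $\exists(\wp)$, $\forall(\wp)$ are its variables, existential and universal variables; $x_1<_\wp x_2$ iff $x_1$ occurs before $x_2$; for $y\in\exists(\wp)$, $\mathrm{Dep}_\wp(y)=\{x\in\forall(\wp):x<_\wp y\}$. A binding prefix $\flat$ is a finite word over pairs $(a,x)\in\mathrm{Args}\times\mathrm{Var}$ with each argument at most once, viewed as a partial function $\mathrm{Args}\rightharpoonup\mathrm{Var}$ with domain $\mathrm{args}(\flat)$ and range $\mathrm{vars}(\flat)$. $\mathrm{Asg}_D(P)$ is the set of functions $P\to D$. A Skolem map for $\wp$ over $D$ is $\theta:\mathrm{Asg}_D(\forall(\wp))\to\mathrm{Asg}_D(\mathrm{vars}(\wp))$ with $\theta(\chi)(x)=\chi(x)$ for universal $x$ and $\theta(\chi_1)(y)=\theta(\chi_2)(y)$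 for existential $y$ whenever $\chi_1,\chi_2$ agree on $\mathrm{Dep}_\wp(y)$. A schema is $\sigma=(\wp(\sigma),\flat(\sigma))$ with $\mathrm{vars}(\wp(\sigma))=\mathrm{vars}(\flat(\sigma))$, $\mathrm{args}(\sigma)=\mathrm{args}(\flat(\sigma))$; $\mathrm{Sch}(A)$ = schemas with argument set $A$. A coupling map $c$ for $S$ over $D$ assigns each $\sigma\in S$ a Skolem map $c(\sigma)$ for $\wp(\sigma)$ over $D$. $c$ is entangled w.r.t. $S'$ over $A'$ iff there is $t:A'\to D$ such that for every $\sigma\in S'$ there is $\chi\in\mathrm{rng}(c(\sigma))$ with $t=(\chi\circ\flat(\sigma))|_{A'}$; otherwise untangled. For a schema $\sigma$: $\exists(\sigma)=\{a\in\mathrm{args}(\sigma):\flat(\sigma)(a)\in\exists(\wp(\sigma))\}$, $\forall(\sigma)=\mathrm{args}(\sigma)\setminus\exists(\sigma)$; $a_1\equiv_\sigma a_2$ iff $\flat(\sigma)(a_1)=\flat(\sigma)(a_2)$; for $a_1\in\forall(\sigma)$, $a_2\in\exists(\sigma)$, $a_1\rightsquigarrow_\sigma a_2$ iff $\flat(\sigma)(a_1)<_{\wp(\sigma)}\flat(\sigma)(a_2)$. Extended arguments: $E=\{(\sigma,a)\in S'\times A':A'\subseteq\mathrm{args}(\sigma)\}$; $(\sigma,a)$ is existential iff $a\in\exists(\sigma)$. Collapsing graph: vertices $E$, edge relation $\equiv$ the transitive closure of $\{(e_1,e_2)\in E^2:(\sigma_1=\sigma_2\Rightarrow a_1\equiv_{\sigma_1}a_2)\wedge(\sigma_1\ne\sigma_2\Rightarrow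 a_1=a_2)\}$, where $e_i=(\sigma_i,a_i)$. It is conflicting iff there are existential $e_1=(\sigma_1,a_1),e_2=(\sigma_2,a_2)\in E$ with $e_1\equiv e_2$ and such that, if $\sigma_1=\sigma_2$, then not $a_1\equiv_{\sigma_1}a_2$. Dependence graph: vertices $E$, with an edge from $e_1$ to $e_2=(\sigma,a_2)$ iff there is $e=(\sigma,a)\in E$ with $e_1\equiv e$ and $a\rightsquigarrow_\sigma a_2$. $S'$ is overlapping over $A'$ iff its collapsing graph is not conflicting and its dependence graph is acyclic. *)

theory Defs
  imports Complex_Main
begin

text \<open>
  The finite non-empty set of arguments is the universe of a type \<open>'a::finite\<close>, the variables are
  the elements of a type \<open>'v\<close>. Words are lists, and partial functions are library maps
  \<open>_ \<rightharpoonup> _\<close>; a total function \<open>P \<rightarrow> D\<close> is a map with domain exactly \<open>P\<close> and range inside \<open>D\<close>.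
\<close>

datatype 'v quant = Exists (qvar: 'v) | Forall (qvar: 'v)

definition quant_prefix :: "'v quant list \<Rightarrow> bool" where
  "quant_prefix p \<longleftrightarrow> distinct (map qvar p)"

definition qp_vars :: "'v quant list \<Rightarrow> 'v set" where
  "qp_vars p = qvar ` set p"

definition qp_ex :: "'v quant list \<Rightarrow> 'v set" where
  "qp_ex p = {x. Exists x \<in> set p}"

definition qp_all :: "'v quant list \<Rightarrow> 'v set" where
  "qp_all p = {x. Forall x \<in> set p}"

definition qp_before :: "'v quant list \<Rightarrow> 'v \<Rightarrow> 'v \<Rightarrow> bool" where
  "qp_before p x y \<longleftrightarrow> (\<exists>i j. i < j \<and> j < length p \<and> qvar (p ! i) = x \<and> qvar (p ! j) = y)"

definition Dep :: "'v quant list \<Rightarrow> 'v \<Rightarrow> 'v set" where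
  "Dep p y = {x \<in> qp_all p. qp_before p x y}"

definition binding_prefix :: "('a \<times> 'v) list \<Rightarrow> bool" where
  "binding_prefix b \<longleftrightarrow> distinct (map fst b)"

definition Asg :: "'d set \<Rightarrow> 'x set \<Rightarrow> ('x \<rightharpoonup> 'd) set" where
  "Asg D P = {f. dom f = P \<and> ran f \<subseteq> D}"

definition skolem_map ::
  "'d set \<Rightarrow> 'v quant list \<Rightarrow> (('v \<rightharpoonup> 'd) \<Rightarrow> ('v \<rightharpoonup> 'd)) \<Rightarrow> bool" where
  "skolem_map D p \<theta> \<longleftrightarrow>
     (\<forall>\<chi> \<in> Asg D (qp_all p). \<theta> \<chi> \<in> Asg D (qp_vars p)) \<and>
     (\<forall>\<chi> \<in> Asg D (qp_all p). \<forall>x \<in> qp_all p. \<theta> \<chi> x = \<chi> x) \<and>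
     (\<forall>y \<in> qp_ex p. \<forall>\<chi>1 \<in> Asg D (qp_all p). \<forall>\<chi>2 \<in> Asg D (qp_all p).
        (\<forall>x \<in> Dep p y. \<chi>1 x = \<chi>2 x) \<longrightarrow> \<theta> \<chi>1 y = \<theta> \<chi>2 y)"

text \<open>A schema is a pair of words; the side conditions are in \<open>is_schema\<close>.\<close>

datatype ('a, 'v) schema = Schema (qpre: "'v quant list") (bpre: "('a \<times> 'v) list")

definition bind :: "('a, 'v) schema \<Rightarrow> 'a \<rightharpoonup> 'v" where
  "bind \<sigma> = map_of (bpre \<sigma>)"

definition args :: "('a, 'v) schema \<Rightarrow> 'a set" where
  "args \<sigma> = dom (bind \<sigma>)"

definition is_schema :: "('a, 'v) schema \<Rightarrow> bool" where
  "is_schema \<sigma> \<longleftrightarrow> quant_prefix (qpre \<sigma>) \<and> binding_prefix (bpre \<sigma>) \<and>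
     qp_vars (qpre \<sigma>) = ran (bind \<sigma>)"

definition Sch :: "'a set \<Rightarrow> ('a, 'v) schema set" where
  "Sch A = {\<sigma>. is_schema \<sigma> \<and> args \<sigma> = A}"

definition coupling_map ::
  "'d set \<Rightarrow> ('a, 'v) schema set \<Rightarrow>
   (('a, 'v) schema \<Rightarrow> ('v \<rightharpoonup> 'd) \<Rightarrow> ('v \<rightharpoonup> 'd)) \<Rightarrow> bool" where
  "coupling_map D S c \<longleftrightarrow> (\<forall>\<sigma> \<in> S. skolem_map D (qpre \<sigma>) (c \<sigma>))"

text \<open>
  The values of a Skolem map outside \<open>Asg D (qp_all p)\<close> are irrelevant, so its range is taken
  as the image of that set.
\<close>

definition entangled ::
  "'d set \<Rightarrow> (('a, 'v) schema \<Rightarrow> ('v \<rightharpoonup> 'd) \<Rightarrow> ('v \<rightharpoonup> 'd)) \<Rightarrow>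
   ('a, 'v) schema set \<Rightarrow> 'a set \<Rightarrow> bool" where
  "entangled D c S' A' \<longleftrightarrow>
     (\<exists>t \<in> Asg D A'. \<forall>\<sigma> \<in> S'. \<exists>\<chi> \<in> c \<sigma> ` Asg D (qp_all (qpre \<sigma>)).
        t = (\<chi> \<circ>\<^sub>m bind \<sigma>) |` A')"

abbreviation untangled ::
  "'d set \<Rightarrow> (('a, 'v) schema \<Rightarrow> ('v \<rightharpoonup> 'd) \<Rightarrow> ('v \<rightharpoonup> 'd)) \<Rightarrow>
   ('a, 'v) schema set \<Rightarrow> 'a set \<Rightarrow> bool" where
  "untangled D c S' A' \<equiv> \<not> entangled D c S' A'"

definition ex_args :: "('a, 'v) schema \<Rightarrow> 'a set" where
  "ex_args \<sigma> = {a \<in> args \<sigma>. the (bind \<sigma> a) \<in> qp_ex (qpre \<sigma>)}"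

definition all_args :: "('a, 'v) schema \<Rightarrow> 'a set" where
  "all_args \<sigma> = args \<sigma> - ex_args \<sigma>"

definition arg_equiv :: "('a, 'v) schema \<Rightarrow> 'a \<Rightarrow> 'a \<Rightarrow> bool" where
  "arg_equiv \<sigma> a1 a2 \<longleftrightarrow> a1 \<in> args \<sigma> \<and> a2 \<in> args \<sigma> \<and> bind \<sigma> a1 = bind \<sigma> a2"

definition arg_dep :: "('a, 'v) schema \<Rightarrow> 'a \<Rightarrow> 'a \<Rightarrow> bool" where
  "arg_dep \<sigma> a1 a2 \<longleftrightarrow> a1 \<in> all_args \<sigma> \<and> a2 \<in> ex_args \<sigma> \<and>
     qp_before (qpre \<sigma>) (the (bind \<sigma> a1)) (the (bind \<sigma> a2))"

type_synonym ('a, 'v) ext_arg = "('a, 'v) schema \<times> 'a"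

definition ext_args :: "('a, 'v) schema set \<Rightarrow> 'a set \<Rightarrow> ('a, 'v) ext_arg set" where
  "ext_args S' A' = {(\<sigma>, a). \<sigma> \<in> S' \<and> a \<in> A' \<and> A' \<subseteq> args \<sigma>}"

definition existential :: "('a, 'v) ext_arg \<Rightarrow> bool" where
  "existential e \<longleftrightarrow> snd e \<in> ex_args (fst e)"

definition collapsing :: "('a, 'v) schema set \<Rightarrow> 'a set \<Rightarrow> ('a, 'v) ext_arg rel" where
  "collapsing S' A' =
     {((\<sigma>1, a1), (\<sigma>2, a2)).
        (\<sigma>1, a1) \<in> ext_args S' A' \<and> (\<sigma>2, a2) \<in> ext_args S' A' \<and>
        (\<sigma>1 = \<sigma>2 \<longrightarrow> arg_equiv \<sigma>1 a1 a2) \<and> (\<sigma>1 \<noteq> \<sigma>2 \<longrightarrow> a1 = a2)}\<^sup>+"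

definition conflicting :: "('a, 'v) schema set \<Rightarrow> 'a set \<Rightarrow> bool" where
  "conflicting S' A' \<longleftrightarrow>
     (\<exists>\<sigma>1 a1 \<sigma>2 a2.
        (\<sigma>1, a1) \<in> ext_args S' A' \<and> (\<sigma>2, a2) \<in> ext_args S' A' \<and>
        existential (\<sigma>1, a1) \<and> existential (\<sigma>2, a2) \<and>
        ((\<sigma>1, a1), (\<sigma>2, a2)) \<in> collapsing S' A' \<and>
        (\<sigma>1 = \<sigma>2 \<longrightarrow> \<not> arg_equiv \<sigma>1 a1 a2))"

definition dependence :: "('a, 'v) schema set \<Rightarrow> 'a set \<Rightarrow> ('a, 'v) ext_arg rel" where
  "dependence S' A' =
     {(e1, (\<sigma>, a2)).
        e1 \<in> ext_args S' A' \<and> (\<sigma>, a2) \<in> ext_args S' A' \<and>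
        (\<exists>a. (\<sigma>, a) \<in> ext_args S' A' \<and> (e1, (\<sigma>, a)) \<in> collapsing S' A' \<and> arg_dep \<sigma> a a2)}"

definition overlapping :: "('a, 'v) schema set \<Rightarrow> 'a set \<Rightarrow> bool" where
  "overlapping S' A' \<longleftrightarrow> \<not> conflicting S' A' \<and> acyclic (dependence S' A')"

end

(* A value of the domain records the existential variable y of the schema \<sigma> that produced it,
   together with one bit for every enumeration l of the set of all pairs (schema, variable).
   The record of origin excludes conflicts. The bit at l copies the bit at l of the universal
   variable x of \<sigma> standing immediately before y in l, and negates it if x is the head of l.
   A shortest dependence cycle alternates universal and existential variables without repetition,
   so some l starts with this cycle; going once around it, the bit at l is negated exactly once. *)
theory Submission
  imports Defs "HOL-Combinatorics.Multiset_Permutations"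
begin

section \<open>Bit vectors indexed by enumerations\<close>

type_synonym ('a, 'v) node = "('a, 'v) schema \<times> 'v"

text \<open>A bit vector is encoded as the set of enumerations whose bit is 1, and
  \<open>B x\<close> is the vector read at \<open>x\<close>. The bit is negated exactly when
  \<open>u\<close> is empty; where \<open>(\<sigma>, y)\<close> has no suitable predecessor in
  \<open>l\<close>, it defaults to 0.\<close>

definition next_bits ::
  "('a, 'v) node set \<Rightarrow> ('a, 'v) schema \<Rightarrow> ('v \<Rightarrow> ('a, 'v) node list set) \<Rightarrow> 'v \<Rightarrow>
   ('a, 'v) node list set" where
  "next_bits V \<sigma> B y = {l \<in> permutations_of_set V. \<exists>u x w.
     l = u @ (\<sigma>, x) # (\<sigma>, y) # w \<and> x \<in> Dep (qpre \<sigma>) y \<and> (l \<in> B x \<longleftrightarrow> u \<noteq> [])}"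

text \<open>An enumeration has no repetitions, so the position of \<open>(\<sigma>, y)\<close> in
  \<open>l\<close> determines \<open>u\<close> and \<open>x\<close>.\<close>

lemma mem_next_bits_iff:
  assumes "l \<in> permutations_of_set V" "l = u @ (\<sigma>, x) # (\<sigma>, y) # w" "x \<in> Dep (qpre \<sigma>) y"
  shows "l \<in> next_bits V \<sigma> B y \<longleftrightarrow> (l \<in> B x \<longleftrightarrow> u \<noteq> [])"
proof -
  have "distinct l"
    using assms(1) by (simp add: permutations_of_set_def)
  have "u' = u \<and> x' = x" if "l = u' @ (\<sigma>, x') # (\<sigma>, y) # w'" for u' x' w'
  proof -
    have "(u @ [(\<sigma>, x)]) @ (\<sigma>, y) # w = (u' @ [(\<sigma>, x')]) @ (\<sigma>, y) # w'"
      using that assms(2) by simp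
    moreover have "(\<sigma>, y) \<notin> set (u @ [(\<sigma>, x)])" "(\<sigma>, y) \<notin> set w"
      using \<open>distinct l\<close> assms(2) by auto
    ultimately have "u @ [(\<sigma>, x)] = u' @ [(\<sigma>, x')]"
      using append_Cons_eq_iff[of "(\<sigma>, y)" "u @ [(\<sigma>, x)]" w] by metis
    then show ?thesis by simp
  qed
  then show ?thesis
    using assms unfolding next_bits_def by blast
qed

section \<open>Acyclicity of the reading relation\<close>

lemma shortest_cycle:
  assumes "\<not> acyclic R"
  obtains f and m :: nat where "m > 0" "f m = f 0" "\<And>i. i < m \<Longrightarrow> (f i, f (Suc i)) \<in> R"
    "inj_on f {..<m}"
proof -
  define P where "P m \<longleftrightarrow> m > 0 \<and> (\<exists>e. (e, e) \<in> R ^^ m)" for m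
  obtain e where "(e, e) \<in> R\<^sup>+"
    using assms by (auto simp: acyclic_def)
  then have "\<exists>m. P m"
    unfolding P_def trancl_power by blast
  then obtain m where m: "P m" and least: "\<And>i. i < m \<Longrightarrow> \<not> P i"
    using exists_least_iff[of P] by blast
  then obtain e f where f: "f 0 = e" "f m = e" "\<And>i. i < m \<Longrightarrow> (f i, f (Suc i)) \<in> R"
    unfolding P_def relpow_fun_conv by blast
  \<comment> \<open>A repeated vertex would cut out a closed walk of length
    \<open>j - i < m\<close>. The index \<open>m\<close> itself is excluded because
    \<open>f m = f 0\<close>.\<close>
  have "f i \<noteq> f j" if "i < j" "j < m" for i j
  proof
    assume eq: "f i = f j"
    have "(f i, f j) \<in> R ^^ (j - i)"
      unfolding relpow_fun_conv
      by (rule exI[of _ "\<lambda>k. f (i + k)"]) (use that f(3) in auto)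
    then have "P (j - i)"
      using eq that unfolding P_def by auto
    then show False
      using least that by auto
  qed
  then have "inj_on f {..<m}"
    by (intro linorder_inj_onI) auto
  then show thesis
    using that m f unfolding P_def by metis
qed

text \<open>To be used with \<open>V\<close> all nodes of \<open>S\<close> and \<open>T\<close> the
  existential nodes of one \<open>S'\<close>. Since the enumerations range over the fixed set
  \<open>V\<close>, the same bit rule serves every \<open>S'\<close>.\<close>

lemma acyclic_reads:
  fixes val :: "('a, 'v) node \<Rightarrow> ('a, 'v) node \<times> ('a, 'v) node list set"
  assumes "finite V" "T \<subseteq> V"
    and dep: "\<And>\<sigma> x y. (\<sigma>, y) \<in> T \<Longrightarrow> x \<in> Dep (qpre \<sigma>) y \<Longrightarrow> (\<sigma>, x) \<in> V - T"
    and val: "\<And>\<sigma> y. (\<sigma>, y) \<in> T \<Longrightarrow>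
      val (\<sigma>, y) = ((\<sigma>, y), next_bits V \<sigma> (\<lambda>x. snd (val (\<sigma>, x))) y)"
  shows "acyclic {(p, (\<sigma>, y)). p \<in> T \<and> (\<sigma>, y) \<in> T \<and>
    (\<exists>x \<in> Dep (qpre \<sigma>) y. val (\<sigma>, x) = val p)}" (is "acyclic ?R")
proof (rule ccontr)
  assume "\<not> acyclic ?R"
  then obtain f and m :: nat where m: "m > 0" and fm: "f m = f 0"
    and edge: "\<And>i. i < m \<Longrightarrow> (f i, f (Suc i)) \<in> ?R" and inj: "inj_on f {..<m}"
    by (rule shortest_cycle) blast
  have "\<forall>i. \<exists>x. i < m \<longrightarrow> x \<in> Dep (qpre (fst (f (Suc i)))) (snd (f (Suc i))) \<and>
      val (fst (f (Suc i)), x) = val (f i)"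
    using edge by fastforce
  then obtain x where
    x: "\<And>i. i < m \<Longrightarrow> x i \<in> Dep (qpre (fst (f (Suc i)))) (snd (f (Suc i)))"
      "\<And>i. i < m \<Longrightarrow> val (fst (f (Suc i)), x i) = val (f i)"
    by metis
  \<comment> \<open>\<open>f (Suc i)\<close> reads the value of \<open>f i\<close> at the node
    \<open>X i\<close> of its own schema.\<close>
  define X where "X i = (fst (f (Suc i)), x i)" for i
  have fT: "f i \<in> T" if "i \<le> m" for i
    using edge[of i] edge[of 0] fm m that by (cases "i = m") auto
  \<comment> \<open>The recorded origin makes \<open>val\<close> injective on \<open>T\<close>;
    hence the \<open>X i\<close>, which carry the values of the distinct \<open>f i\<close>, are
    distinct as well.\<close>
  have tag: "fst (val (f i)) = f i" if "i \<le> m" for i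
    using val[of "fst (f i)" "snd (f i)"] fT[OF that] by simp
  have XV: "X i \<in> V - T" if "i < m" for i
    using dep[of "fst (f (Suc i))" "snd (f (Suc i))"] fT[of "Suc i"] x(1) that
    by (simp add: X_def)
  have f_eq: "i = j" if "i < m" "j < m" "f i = f j" for i j
    using inj that by (auto dest: inj_onD)
  \<comment> \<open>The shifted indices run over \<open>1, ..., m\<close>, so the case
    \<open>Suc i = m\<close> wraps around to \<open>f 0\<close>.\<close>
  have fS_eq: "i = j" if "i < m" "j < m" "f (Suc i) = f (Suc j)" for i j
  proof (cases "Suc i = m \<or> Suc j = m")
    case True
    then show ?thesis
      using that fm m f_eq[of "Suc i" 0] f_eq[of 0 "Suc j"]
      by (metis Suc_lessI nat.distinct(1) nat.inject)
  next
    case False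
    then show ?thesis
      using that f_eq[of "Suc i" "Suc j"] by simp
  qed
  have X_eq: "i = j" if "i < m" "j < m" "X i = X j" for i j
  proof -
    have "val (f i) = val (f j)"
      using x(2)[of i] x(2)[of j] that unfolding X_def by simp
    then have "f i = f j"
      using tag that by (metis less_imp_le)
    then show ?thesis
      using f_eq that by blast
  qed
  \<comment> \<open>\<open>L m\<close> is the list
    \<open>X 0, f 1, X 1, f 2, ..., X (m - 1), f m\<close>: each \<open>f (Suc i)\<close> stands
    directly behind the node it reads.\<close>
  define L where "L i = concat (map (\<lambda>j. [X j, f (Suc j)]) [0..<i])" for i
  have set_L: "set (L i) = X ` {..<i} \<union> (f \<circ> Suc) ` {..<i}" for i
    by (auto simp: L_def)
  have "distinct (L i)" if "i \<le> m" for i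
    using that
  proof (induction i)
    case 0
    then show ?case by (simp add: L_def)
  next
    case (Suc i)
    have Xf: "X j \<noteq> f (Suc j')" if "j \<le> i" "j' \<le> i" for j j'
      using XV[of j] fT[of "Suc j'"] that Suc.prems by fastforce
    have "X i \<noteq> X j" "f (Suc i) \<noteq> f (Suc j)" if "j < i" for j
      using X_eq[of i j] fS_eq[of i j] that Suc.prems by auto
    then have "X i \<notin> set (L i)" "f (Suc i) \<notin> set (L i)" "X i \<noteq> f (Suc i)"
      using Xf[of i] Xf[of _ i] unfolding set_L
      by (metis Un_iff comp_apply image_iff lessThan_iff less_imp_le order_refl)+
    moreover have "L (Suc i) = L i @ [X i, f (Suc i)]"
      by (simp add: L_def)
    ultimately show ?case
      using Suc by simp
  qed
  moreover have "set (L m) \<subseteq> V"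
    using XV fT \<open>T \<subseteq> V\<close> unfolding set_L by (auto simp: Suc_le_eq)
  \<comment> \<open>The nodes off the cycle follow in any order, which completes \<open>L m\<close>
    to an enumeration of \<open>V\<close>.\<close>
  moreover obtain r where r: "set r = V - set (L m)" "distinct r"
    using \<open>finite V\<close> finite_distinct_list by blast
  ultimately have perm: "L m @ r \<in> permutations_of_set V"
    by (auto simp: permutations_of_set_def)
  define b where "b i \<longleftrightarrow> L m @ r \<in> snd (val (f i))" for i
  have step: "b (Suc i) \<longleftrightarrow> (b i \<longleftrightarrow> i \<noteq> 0)" if "i < m" for i
  proof -
    obtain \<sigma> y where fi: "f (Suc i) = (\<sigma>, y)"
      by fastforce
    have "[0..<m] = [0..<i] @ i # [Suc i..<m]"
      using that by (metis upt_add_eq_append upt_conv_Cons le_add_diff_inverse less_imp_le le0)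
    then have split: "L m @ r = L i @ (\<sigma>, x i) # (\<sigma>, y) #
        concat (map (\<lambda>j. [X j, f (Suc j)]) [Suc i..<m]) @ r"
      using fi by (simp add: L_def X_def)
    \<comment> \<open>\<open>L i\<close> takes the role of \<open>u\<close> in the bit rule, so only
      the step from \<open>f 0\<close> to \<open>f 1\<close> negates the bit.\<close>
    have "L i = [] \<longleftrightarrow> i = 0"
      by (cases i) (auto simp: L_def)
    then show ?thesis
      using mem_next_bits_iff[OF perm split, of "\<lambda>x. snd (val (\<sigma>, x))"]
        val[of \<sigma> y] fT[of "Suc i"] x[OF that] fi that
      by (simp add: b_def)
  qed
  have "b (Suc i) \<longleftrightarrow> \<not> b 0" if "i < m" for i
    using that
  proof (induction i)
    case 0
    then show ?case using step[of 0] by simp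
  next
    case (Suc i)
    then show ?case using step[of "Suc i"] by simp
  qed
  from this[of "m - 1"] have "b m \<longleftrightarrow> \<not> b 0"
    using m by simp
  then show False
    using fm by (simp add: b_def)
qed

section \<open>The finite domain and the coupling map\<close>

definition nodes :: "('a, 'v) schema set \<Rightarrow> ('a, 'v) node set" where
  "nodes S = (SIGMA \<sigma>:S. qp_vars (qpre \<sigma>))"

definition ex_nodes :: "('a, 'v) schema set \<Rightarrow> ('a, 'v) node set" where
  "ex_nodes S = (SIGMA \<sigma>:S. qp_ex (qpre \<sigma>))"

definition parity_values ::
  "('a, 'v) schema set \<Rightarrow> (('a, 'v) node \<times> ('a, 'v) node list set) set" where
  "parity_values S = ex_nodes S \<times> Pow (permutations_of_set (nodes S))"

text \<open>\<open>enc\<close> is meant to be injective on \<open>parity_values S\<close>, so that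
  \<open>inv_into\<close> recovers the bits of the universal values. Taking it as a parameter leaves
  the element type of the domain open.\<close>

definition parity_coupling ::
  "('a, 'v) schema set \<Rightarrow> (('a, 'v) node \<times> ('a, 'v) node list set \<Rightarrow> 'd) \<Rightarrow>
   ('a, 'v) schema \<Rightarrow> ('v \<rightharpoonup> 'd) \<Rightarrow> ('v \<rightharpoonup> 'd)" where
  "parity_coupling S enc \<sigma> \<chi> x =
     (if x \<in> qp_all (qpre \<sigma>) then \<chi> x
      else if x \<in> qp_ex (qpre \<sigma>) then
        Some (enc ((\<sigma>, x), next_bits (nodes S) \<sigma>
          (\<lambda>z. snd (inv_into (parity_values S) enc (the (\<chi> z)))) x))
      else None)"

section \<open>Variables of a prefix, finiteness and cardinality\<close>

lemma qp_vars_eq: "qp_vars p = qp_ex p \<union> qp_all p"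
proof -
  have "x \<in> qvar ` set p \<longleftrightarrow> Exists x \<in> set p \<or> Forall x \<in> set p" for x
    by (metis image_iff quant.exhaust_sel quant.sel)
  then show ?thesis
    by (auto simp: qp_vars_def qp_ex_def qp_all_def)
qed

lemma qp_ex_all_disjoint:
  assumes "quant_prefix p"
  shows "qp_ex p \<inter> qp_all p = {}"
proof -
  have "inj_on qvar (set p)"
    using assms by (simp add: quant_prefix_def distinct_map)
  then have "Forall x \<notin> set p" if "Exists x \<in> set p" for x
    using that by (metis inj_onD quant.distinct(1) quant.sel)
  then show ?thesis
    by (auto simp: qp_ex_def qp_all_def)
qed

lemma finite_qp_ex: "finite (qp_ex p)"
  using finite_subset[of "qp_ex p" "qp_vars p"] qp_vars_eq[of p] by (auto simp: qp_vars_def)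

lemma finite_nodes: "finite S \<Longrightarrow> finite (nodes S)"
  by (auto simp: nodes_def qp_vars_def)

lemma finite_ex_nodes: "finite S \<Longrightarrow> finite (ex_nodes S)"
  by (auto simp: ex_nodes_def finite_qp_ex)

lemma finite_parity_values: "finite S \<Longrightarrow> finite (parity_values S)"
  by (simp add: parity_values_def finite_ex_nodes)

text \<open>An origin is one of at most \<open>card S * h\<close> existential nodes; a bit vector is
  a subset of the enumerations of at most \<open>card S * k\<close> nodes.\<close>

lemma card_parity_values:
  assumes "finite S"
    and h: "\<And>\<sigma>. \<sigma> \<in> S \<Longrightarrow> card (qp_ex (qpre \<sigma>)) \<le> h"
    and k: "\<And>\<sigma>. \<sigma> \<in> S \<Longrightarrow> card (qp_vars (qpre \<sigma>)) \<le> k"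
  shows "card (parity_values S) \<le> card S * h * 2 ^ fact (card S * k)"
proof -
  have "card (nodes S) \<le> card S * k"
    using sum_bounded_above[of S "\<lambda>\<sigma>. card (qp_vars (qpre \<sigma>))" k] assms
    by (simp add: nodes_def qp_vars_def)
  then have "(fact (card (nodes S)) :: nat) \<le> fact (card S * k)"
    by (rule fact_mono)
  then have "(2::nat) ^ fact (card (nodes S)) \<le> 2 ^ fact (card S * k)"
    by (intro power_increasing) auto
  moreover have "card (ex_nodes S) \<le> card S * h"
    using sum_bounded_above[of S "\<lambda>\<sigma>. card (qp_ex (qpre \<sigma>))" h] assms
    by (simp add: ex_nodes_def finite_qp_ex)
  ultimately have
    "card (ex_nodes S) * 2 ^ fact (card (nodes S)) \<le> card S * h * 2 ^ fact (card S * k)"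
    by (rule mult_le_mono[rotated])
  then show ?thesis
    by (simp add: parity_values_def card_cartesian_product card_Pow finite_nodes \<open>finite S\<close>)
qed

section \<open>The Skolem property\<close>

lemma next_bits_subset: "next_bits V \<sigma> B y \<subseteq> permutations_of_set V"
  by (auto simp: next_bits_def)

text \<open>This is the source of the independence condition on Skolem maps: the rule consults
  \<open>B\<close> only on \<open>Dep\<close>.\<close>

lemma next_bits_cong:
  "(\<And>x. x \<in> Dep (qpre \<sigma>) y \<Longrightarrow> B x = B' x) \<Longrightarrow> next_bits V \<sigma> B y = next_bits V \<sigma> B' y"
  by (simp add: next_bits_def cong: conj_cong)

lemma parity_coupling_all: "x \<in> qp_all (qpre \<sigma>) \<Longrightarrow> parity_coupling S enc \<sigma> \<chi> x = \<chi> x"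
  by (simp add: parity_coupling_def)

lemma parity_value_mem:
  "\<sigma> \<in> S \<Longrightarrow> y \<in> qp_ex (qpre \<sigma>) \<Longrightarrow>
    ((\<sigma>, y), next_bits (nodes S) \<sigma> B y) \<in> parity_values S"
  using next_bits_subset[of "nodes S" \<sigma> B y] by (simp add: parity_values_def ex_nodes_def)

lemma skolem_map_parity_coupling:
  assumes "\<sigma> \<in> S" "is_schema \<sigma>"
  shows "skolem_map (enc ` parity_values S) (qpre \<sigma>) (parity_coupling S enc \<sigma>)"
  unfolding skolem_map_def
proof (intro conjI ballI impI)
  have disj: "qp_ex (qpre \<sigma>) \<inter> qp_all (qpre \<sigma>) = {}"
    using assms by (intro qp_ex_all_disjoint) (simp add: is_schema_def)
  fix \<chi> assume \<chi>: "\<chi> \<in> Asg (enc ` parity_values S) (qp_all (qpre \<sigma>))"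
  show "parity_coupling S enc \<sigma> \<chi> \<in> Asg (enc ` parity_values S) (qp_vars (qpre \<sigma>))"
  proof -
    have "dom (parity_coupling S enc \<sigma> \<chi>) = qp_vars (qpre \<sigma>)"
    proof -
      have "\<chi> x = None \<longleftrightarrow> x \<notin> qp_all (qpre \<sigma>)" for x
        using \<chi> by (auto simp: Asg_def)
      then show ?thesis
        by (auto simp: parity_coupling_def qp_vars_eq dom_def simp del: not_None_eq)
    qed
    moreover have "d \<in> enc ` parity_values S" if "parity_coupling S enc \<sigma> \<chi> x = Some d" for x d
      using that \<chi> parity_value_mem[OF \<open>\<sigma> \<in> S\<close>]
      by (auto simp: Asg_def ran_def parity_coupling_def split: if_splits)
    ultimately show ?thesis
      by (auto simp: Asg_def ran_def)
  qed
  show "parity_coupling S enc \<sigma> \<chi> x = \<chi> x" if "x \<in> qp_all (qpre \<sigma>)" for x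
    using that by (rule parity_coupling_all)
  show "parity_coupling S enc \<sigma> \<chi> y = parity_coupling S enc \<sigma> \<chi>' y"
    if "y \<in> qp_ex (qpre \<sigma>)" "\<forall>x \<in> Dep (qpre \<sigma>) y. \<chi> x = \<chi>' x" for y \<chi>'
  proof -
    have "y \<notin> qp_all (qpre \<sigma>)"
      using that disj by blast
    then show ?thesis
      using that by (auto simp: parity_coupling_def intro!: arg_cong[where f = enc] next_bits_cong)
  qed
qed

section \<open>Entanglement forces overlapping\<close>

lemma untangled_parity_coupling:
  fixes S S' :: "('a, 'v) schema set"
  assumes "finite S" and schema: "\<And>\<sigma>. \<sigma> \<in> S \<Longrightarrow> is_schema \<sigma>"
    and enc: "inj_on enc (parity_values S)"
    and S': "S' \<subseteq> S" and "\<not> overlapping S' A'"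
  shows "untangled (enc ` parity_values S) (parity_coupling S enc) S' A'"
proof
  assume "entangled (enc ` parity_values S) (parity_coupling S enc) S' A'"
  then obtain t where "\<forall>\<sigma> \<in> S'. \<exists>\<xi>. t = (parity_coupling S enc \<sigma> \<xi> \<circ>\<^sub>m bind \<sigma>) |` A'"
    unfolding entangled_def by blast
  then obtain \<xi> where t: "\<And>\<sigma>. \<sigma> \<in> S' \<Longrightarrow> t = (parity_coupling S enc \<sigma> (\<xi> \<sigma>) \<circ>\<^sub>m bind \<sigma>) |` A'"
    by metis
  define dec where "dec = inv_into (parity_values S) enc"
  define val where "val = (\<lambda>(\<sigma>, x). dec (the (parity_coupling S enc \<sigma> (\<xi> \<sigma>) x)))"
  \<comment> \<open>All the chosen assignments agree with \<open>t\<close>, so the value at the node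
    of \<open>(\<sigma>, a)\<close> depends on \<open>a\<close> alone. This links different
    schemas.\<close>
  have t_val: "val (\<sigma>, the (bind \<sigma> a)) = dec (the (t a))" if "(\<sigma>, a) \<in> ext_args S' A'" for \<sigma> a
  proof -
    have "\<sigma> \<in> S'" "a \<in> A'" "a \<in> dom (bind \<sigma>)"
      using that by (auto simp: ext_args_def args_def)
    then show ?thesis
      using t[of \<sigma>] by (auto simp: val_def map_comp_def)
  qed
  have disj: "qp_ex (qpre \<sigma>) \<inter> qp_all (qpre \<sigma>) = {}" if "\<sigma> \<in> S'" for \<sigma>
    using schema S' that by (intro qp_ex_all_disjoint) (auto simp: is_schema_def)
  \<comment> \<open>Injectivity of \<open>enc\<close> undoes the encoding. Universal variables keep
    their values, so on \<open>Dep\<close> the bits of \<open>\<xi> \<sigma>\<close> are those of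
    \<open>val\<close>.\<close>
  have val: "val (\<sigma>, y) = ((\<sigma>, y), next_bits (nodes S) \<sigma> (\<lambda>x. snd (val (\<sigma>, x))) y)"
    if "(\<sigma>, y) \<in> ex_nodes S'" for \<sigma> y
  proof -
    have \<sigma>: "\<sigma> \<in> S'" and y: "y \<in> qp_ex (qpre \<sigma>)" "y \<notin> qp_all (qpre \<sigma>)"
      using that disj by (auto simp: ex_nodes_def)
    have "val (\<sigma>, y) = ((\<sigma>, y), next_bits (nodes S) \<sigma> (\<lambda>x. snd (dec (the (\<xi> \<sigma> x)))) y)"
      using y \<sigma> S' enc by (simp add: val_def parity_coupling_def dec_def parity_value_mem subsetD)
    moreover have "next_bits (nodes S) \<sigma> (\<lambda>x. snd (dec (the (\<xi> \<sigma> x)))) y =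
        next_bits (nodes S) \<sigma> (\<lambda>x. snd (val (\<sigma>, x))) y"
      by (rule next_bits_cong) (simp add: val_def Dep_def parity_coupling_all)
    ultimately show ?thesis by simp
  qed
  have ex_node: "(\<sigma>, the (bind \<sigma> a)) \<in> ex_nodes S'"
    if "(\<sigma>, a) \<in> ext_args S' A'" "a \<in> ex_args \<sigma>" for \<sigma> a
    using that by (auto simp: ext_args_def ex_args_def ex_nodes_def)
  have collapse_step: "t a1 = t a2"
    if "(\<sigma>1, a1) \<in> ext_args S' A'" "(\<sigma>2, a2) \<in> ext_args S' A'"
      "\<sigma>1 = \<sigma>2 \<longrightarrow> arg_equiv \<sigma>1 a1 a2" "\<sigma>1 \<noteq> \<sigma>2 \<longrightarrow> a1 = a2" for \<sigma>1 a1 \<sigma>2 a2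
  proof (cases "\<sigma>1 = \<sigma>2")
    case True
    then have "\<sigma>1 \<in> S'" "a1 \<in> A'" "a2 \<in> A'" "bind \<sigma>1 a1 = bind \<sigma>1 a2"
      using that by (auto simp: ext_args_def arg_equiv_def)
    then show ?thesis
      using t[of \<sigma>1] by (simp add: map_comp_def)
  qed (use that in auto)
  \<comment> \<open>A generating pair shares either a variable within one schema or the argument
    itself; \<open>t\<close> cannot separate the two ends, nor therefore the ends of a
    chain.\<close>
  have collapsing_t: "t (snd e1) = t (snd e2)" if "(e1, e2) \<in> collapsing S' A'" for e1 e2
    using that unfolding collapsing_def
  proof (induction rule: trancl_induct)
    case (base e)
    then show ?case
      using collapse_step by (cases e1; cases e) auto
  next
    case (step e e')
    then have "t (snd e) = t (snd e')"
      using collapse_step by (cases e; cases e') auto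
    then show ?case
      using step.IH by simp
  qed
  have "\<not> conflicting S' A'"
  proof
    assume "conflicting S' A'"
    then obtain \<sigma>1 a1 \<sigma>2 a2 where e: "(\<sigma>1, a1) \<in> ext_args S' A'" "(\<sigma>2, a2) \<in> ext_args S' A'"
      "a1 \<in> ex_args \<sigma>1" "a2 \<in> ex_args \<sigma>2" "((\<sigma>1, a1), (\<sigma>2, a2)) \<in> collapsing S' A'"
      "\<sigma>1 = \<sigma>2 \<longrightarrow> \<not> arg_equiv \<sigma>1 a1 a2"
      by (auto simp: conflicting_def existential_def)
    have "val (\<sigma>1, the (bind \<sigma>1 a1)) = val (\<sigma>2, the (bind \<sigma>2 a2))"
      using t_val e(1,2) collapsing_t[OF e(5)] by simp
    \<comment> \<open>Equal values have equal origins.\<close>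
    then have "\<sigma>1 = \<sigma>2" "the (bind \<sigma>1 a1) = the (bind \<sigma>2 a2)"
      using val ex_node e by (metis fst_conv snd_conv)+
    then show False
      using e by (auto simp: arg_equiv_def ex_args_def args_def)
  qed
  moreover have "acyclic (dependence S' A')"
  proof -
    \<comment> \<open>\<open>R\<close> is the relation of \<open>acyclic_reads\<close> for
      \<open>T = ex_nodes S'\<close>; \<open>g\<close> replaces an argument by the variable it is
      bound to.\<close>
    define R where "R = {(p, (\<sigma>, y)). p \<in> ex_nodes S' \<and> (\<sigma>, y) \<in> ex_nodes S' \<and>
      (\<exists>x \<in> Dep (qpre \<sigma>) y. val (\<sigma>, x) = val p)}"
    define g where "g = (\<lambda>(\<sigma>, a). (\<sigma> :: ('a, 'v) schema, the (bind \<sigma> (a :: 'a))))"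
    have "acyclic R"
      unfolding R_def
    proof (rule acyclic_reads[OF finite_nodes[OF \<open>finite S\<close>] _ _ val])
      show "ex_nodes S' \<subseteq> nodes S"
        using S' by (auto simp: ex_nodes_def nodes_def qp_vars_eq)
      show "(\<sigma>, x) \<in> nodes S - ex_nodes S'"
        if "(\<sigma>, y) \<in> ex_nodes S'" "x \<in> Dep (qpre \<sigma>) y" for \<sigma> x y
        using that S' disj by (auto simp: ex_nodes_def nodes_def qp_vars_eq Dep_def)
    qed
    \<comment> \<open>Only edges with an existential source map into \<open>R\<close>. By
      \<open>arg_dep\<close> every edge ends in an existential argument, so this condition
      propagates along paths.\<close>
    have edge: "(g e1, g e2) \<in> R \<and> existential e2"
      if d: "(e1, e2) \<in> dependence S' A'" "existential e1" for e1 e2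
    proof -
      obtain \<sigma>1 a1 \<sigma> a2 where e12: "e1 = (\<sigma>1, a1)" "e2 = (\<sigma>, a2)"
        by fastforce
      then obtain a where "(\<sigma>1, a1) \<in> ext_args S' A'"
        "(\<sigma>, a2) \<in> ext_args S' A'" "(\<sigma>, a) \<in> ext_args S' A'"
        "((\<sigma>1, a1), (\<sigma>, a)) \<in> collapsing S' A'" "arg_dep \<sigma> a a2"
        using d(1) by (auto simp: dependence_def)
      note e = e12 this
      have "is_schema \<sigma>"
        using e S' schema by (auto simp: ext_args_def)
      \<comment> \<open>In a schema every bound variable is quantified, so a non-existential
        argument is bound to a universal variable.\<close>
      then have "the (bind \<sigma> a) \<in> qp_all (qpre \<sigma>)"
        using e(7) ranI[of "bind \<sigma>" a]
        by (auto simp: arg_dep_def all_args_def ex_args_def args_def is_schema_def qp_vars_eq)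
      then have "the (bind \<sigma> a) \<in> Dep (qpre \<sigma>) (the (bind \<sigma> a2))"
        using e(7) by (simp add: Dep_def arg_dep_def)
      moreover have "val (\<sigma>, the (bind \<sigma> a)) = val (\<sigma>1, the (bind \<sigma>1 a1))"
        using t_val e(3,5) collapsing_t[OF e(6)] by simp
      moreover have "a1 \<in> ex_args \<sigma>1" "a2 \<in> ex_args \<sigma>"
        using d(2) e by (auto simp: existential_def arg_dep_def)
      ultimately show ?thesis
        using ex_node e by (auto simp: R_def g_def existential_def)
    qed
    have path: "(g e1, g e2) \<in> R\<^sup>+ \<and> existential e2"
      if "(e1, e2) \<in> (dependence S' A')\<^sup>+" "existential e1" for e1 e2
      using that
    proof (induction rule: trancl_induct)
      case (step e e')
      then show ?case
        using edge by (meson trancl.trancl_into_trancl)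
    qed (use edge in blast)
    show ?thesis
    proof (rule acyclicI, intro allI notI)
      fix e
      assume e: "(e, e) \<in> (dependence S' A')\<^sup>+"
      \<comment> \<open>The last edge of the cycle ends in \<open>e\<close>, so the whole cycle maps
        to a cycle of \<open>R\<close>.\<close>
      then have "existential e"
        by (auto simp: dependence_def existential_def arg_dep_def dest: tranclD2)
      then show False
        using path[OF e] \<open>acyclic R\<close> unfolding acyclic_def by blast
    qed
  qed
  ultimately show False
    using \<open>\<not> overlapping S' A'\<close> by (simp add: overlapping_def)
qed

theorem mainTheorem12:
  fixes S :: "('a::finite, 'v) schema set" and n h k :: nat
  assumes "finite S" and "\<forall>\<sigma> \<in> S. is_schema \<sigma>"
    and "n = card S"
    and "h = Max ((\<lambda>\<sigma>. card (qp_ex (qpre \<sigma>))) ` S)"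
    and "k = Max ((\<lambda>\<sigma>. card (args \<sigma>)) ` S)"
  shows "\<exists>(D :: nat set) c.
           finite D \<and> card D \<le> n * h * 2 ^ fact (n * k) \<and> coupling_map D S c \<and>
           (\<forall>A A' S'. A' \<subseteq> A \<longrightarrow> S' \<subseteq> S \<inter> Sch A \<longrightarrow>
              \<not> overlapping S' A' \<longrightarrow> untangled D c S' A')"
proof -
  \<comment> \<open>For empty \<open>S\<close> the two \<open>Max\<close> terms are unspecified, but
    then the bounds by \<open>h\<close> and \<open>k\<close> hold vacuously.\<close>
  have "card (qp_ex (qpre \<sigma>)) \<le> h" if "\<sigma> \<in> S" for \<sigma>
    using that assms by simp
  moreover have "card (qp_vars (qpre \<sigma>)) \<le> k" if "\<sigma> \<in> S" for \<sigma>
  proof -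
    \<comment> \<open>Each quantified variable is bound by some argument, so the number of arguments
      bounds the number of variables.\<close>
    have "qp_vars (qpre \<sigma>) = (the \<circ> bind \<sigma>) ` args \<sigma>"
      using that assms(2) by (force simp: is_schema_def args_def ran_def dom_def)
    then have "card (qp_vars (qpre \<sigma>)) \<le> card (args \<sigma>)"
      by (simp add: card_image_le)
    then show ?thesis
      using that assms(1,5) by (meson Max_ge dual_order.trans finite_imageI imageI)
  qed
  ultimately have card: "card (parity_values S) \<le> n * h * 2 ^ fact (n * k)"
    using card_parity_values assms by blast
  \<comment> \<open>Numbering the finitely many values gives a domain of natural numbers.\<close>
  obtain enc :: "_ \<Rightarrow> nat" where enc: "inj_on enc (parity_values S)"
    using finite_imp_inj_to_nat_seg[OF finite_parity_values[OF \<open>finite S\<close>]] by blast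
  show ?thesis
  proof (intro exI conjI allI impI)
    show "finite (enc ` parity_values S)"
      using assms(1) by (simp add: finite_parity_values)
    show "card (enc ` parity_values S) \<le> n * h * 2 ^ fact (n * k)"
      using card enc by (simp add: card_image)
    show "coupling_map (enc ` parity_values S) S (parity_coupling S enc)"
      using assms(2) by (simp add: coupling_map_def skolem_map_parity_coupling)
    show "untangled (enc ` parity_values S) (parity_coupling S enc) S' A'"
      if "S' \<subseteq> S \<inter> Sch A" "\<not> overlapping S' A'" for A A' S'
      using that assms enc by (intro untangled_parity_coupling) auto
  qed
qed

end
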